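(* Let $\mu_X,\mu_Y\in\mathbb{R}$, $\sigma_X,\sigma_Y>0$, $\rho\in(-1,1)$ and let $n\geq1$ be an integer. Let $(X,Y)$ be a bivariate normal random vector with mean vector $(\mu_X,\mu_Y)$, variances $(\sigma_X^2,\sigma_Y^2)$ and correlation coefficient $\rho$, let $Z=XY$, and let $S_n=\sum_{i=1}^n Z_i$, where $Z_1,\ldots,Z_n$ are independent copies of $Z$. Put $$\lambda_+=\frac{n}{2(1+\rho)}\bigg(\frac{\mu_X}{\sigma_X}+\frac{\mu_Y}{\sigma_Y}\bigg)^2,\quad \lambda_-=\frac{n}{2(1-\rho)}\bigg(\frac{\mu_X}{\sigma_X}-\frac{\mu_Y}{\sigma_Y}\bigg)^2.$$ Then $$\mathbb{P}(S_n\leq0)=\mathrm{e}^{-(\lambda_++\lambda_-)/2}\sum_{j=0}^\infty\sum_{k=0}^\infty\frac{1}{j!\,k!}\bigg(\frac{\lambda_+}{2}\bigg)^j\bigg(\frac{\lambda_-}{2}\bigg)^kI_{\frac{1-\rho}{2}}\bigg(\frac{n}{2}+j,\frac{n}{2}+k\bigg).$$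
   Context: $I_x(a,b)=B_x(a,b)/B(a,b)$ is the regularized incomplete beta function, where $B_x(a,b)=\int_0^xt^{a-1}(1-t)^{b-1}\,\mathrm{d}t$ is the incomplete beta function and $B(a,b)=B_1(a,b)$ is the beta function. The convention $0^0=1$ is used. *)

theory Defs
  imports "HOL-Probability.Probability"
begin

text \<open>
  Joint density of a nondegenerate (\<open>\<bar>\<rho>\<bar> < 1\<close>) bivariate normal vector with mean \<open>(\<mu>\<^sub>X, \<mu>\<^sub>Y)\<close>,
  variances \<open>(\<sigma>\<^sub>X\<^sup>2, \<sigma>\<^sub>Y\<^sup>2)\<close> and correlation coefficient \<open>\<rho>\<close>.  As in \<^const>\<open>normal_density\<close>,
  the scale parameters are standard deviations, not variances.
\<close>
definition bivariate_normal_density ::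
    "real \<Rightarrow> real \<Rightarrow> real \<Rightarrow> real \<Rightarrow> real \<Rightarrow> real \<times> real \<Rightarrow> real" where
  "bivariate_normal_density \<mu>\<^sub>X \<mu>\<^sub>Y \<sigma>\<^sub>X \<sigma>\<^sub>Y \<rho> = (\<lambda>(x, y).
     1 / (2 * pi * \<sigma>\<^sub>X * \<sigma>\<^sub>Y * sqrt (1 - \<rho>\<^sup>2)) *
     exp (- (((x - \<mu>\<^sub>X) / \<sigma>\<^sub>X)\<^sup>2 - 2 * \<rho> * ((x - \<mu>\<^sub>X) / \<sigma>\<^sub>X) * ((y - \<mu>\<^sub>Y) / \<sigma>\<^sub>Y)
             + ((y - \<mu>\<^sub>Y) / \<sigma>\<^sub>Y)\<^sup>2) / (2 * (1 - \<rho>\<^sup>2))))"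

definition bivariate_normal ::
    "'a measure \<Rightarrow> ('a \<Rightarrow> real) \<Rightarrow> ('a \<Rightarrow> real) \<Rightarrow> real \<Rightarrow> real \<Rightarrow> real \<Rightarrow> real \<Rightarrow> real \<Rightarrow> bool" where
  "bivariate_normal M X Y \<mu>\<^sub>X \<mu>\<^sub>Y \<sigma>\<^sub>X \<sigma>\<^sub>Y \<rho> \<longleftrightarrow>
     distributed M (lborel \<Otimes>\<^sub>M lborel) (\<lambda>\<omega>. (X \<omega>, Y \<omega>))
       (\<lambda>p. ennreal (bivariate_normal_density \<mu>\<^sub>X \<mu>\<^sub>Y \<sigma>\<^sub>X \<sigma>\<^sub>Y \<rho> p))"

text \<open>
  Meaningful for \<open>a, b > 0\<close> and \<open>0 \<le> x \<le> 1\<close>.  The value \<open>0 powr c = 0\<close> only affects the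
  integrand at the endpoints.
\<close>
definition inc_beta :: "real \<Rightarrow> real \<Rightarrow> real \<Rightarrow> real" where
  "inc_beta x a b = integral {0..x} (\<lambda>t. t powr (a - 1) * (1 - t) powr (b - 1))"

definition reg_inc_beta :: "real \<Rightarrow> real \<Rightarrow> real \<Rightarrow> real" where
  "reg_inc_beta x a b = inc_beta x a b / inc_beta 1 a b"

lemma inc_beta_1: "a > 0 \<Longrightarrow> b > 0 \<Longrightarrow> inc_beta 1 a b = Beta a b"
  unfolding inc_beta_def by (intro integral_unique has_integral_Beta_real)

end

theory Submission imports Defs begin

text \<open>
  Rotate the standardised vector: with \<open>U = (X/\<sigma>\<^sub>X + Y/\<sigma>\<^sub>Y) / sqrt (2(1+\<rho>))\<close> and
  \<open>V = (X/\<sigma>\<^sub>X - Y/\<sigma>\<^sub>Y) / sqrt (2(1-\<rho>))\<close> the variables \<open>U\<close>, \<open>V\<close> are independent normals of variance 1 and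
  \<open>X Y = \<sigma>\<^sub>X \<sigma>\<^sub>Y ((1+\<rho>) U\<^sup>2/2 - (1-\<rho>) V\<^sup>2/2)\<close>.  Half the square of a normal variable with mean \<open>m\<close> and
  variance 1 is noncentral gamma: a mixture of the laws Gamma\<open>(1/2 + j)\<close> of rate 1 whose index \<open>j\<close> is
  Poisson\<open>(m\<^sup>2/2)\<close> (\<open>distr_half_square_normal\<close>; this is the noncentral chi-squared law with one degree of
  freedom, halved).  So the law of a single product is that of a weighted difference of two
  independent noncentral gamma variables (\<open>distr_bivariate_normal_product\<close>).

  Both the gamma laws and the Poisson laws are convolution semigroups, hence so are the noncentral gamma
  laws, and with them the laws of such differences (\<open>nc_gamma_difference_convolution\<close>).  Therefore
  \<open>S\<^sub>n\<close> is distributed as \<open>\<sigma>\<^sub>X \<sigma>\<^sub>Y ((1+\<rho>) A - (1-\<rho>) B)\<close>, where \<open>A\<close> and \<open>B\<close> are independent noncentral gamma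
  variables with shape \<open>n/2\<close> and Poisson means \<open>\<lambda>\<^sub>+/2\<close> and \<open>\<lambda>\<^sub>-/2\<close>.

  The event \<open>S\<^sub>n \<le> 0\<close> is \<open>A / (A + B) \<le> (1-\<rho>)/2\<close>.  Given the two Poisson indices \<open>j\<close>, \<open>k\<close>, the ratio is
  Beta\<open>(n/2 + j, n/2 + k)\<close>-distributed, so the conditional probability is a regularized incomplete beta
  value (\<open>gamma_ratio_probability\<close>); averaging over \<open>j\<close> and \<open>k\<close> gives the double series.  All sums
  and integrals are taken in the extended nonnegative reals, where they may be interchanged freely;
  summability follows at the end because the total is a probability.
\<close>

section \<open>Gamma laws and the incomplete beta function\<close>

definition gamma_density :: "real \<Rightarrow> real \<Rightarrow> real" where
  "gamma_density a x = (if x > 0 then x powr (a - 1) * exp (- x) / Gamma a else 0)"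

lemma gamma_density_nonneg: "a > 0 \<Longrightarrow> gamma_density a x \<ge> 0"
  by (simp add: gamma_density_def Gamma_real_pos less_imp_le)

lemma borel_measurable_gamma_density [measurable]: "gamma_density a \<in> borel_measurable borel"
  unfolding gamma_density_def[abs_def] by measurable

lemma inc_beta_integrable:
  assumes "a > 0" "b > 0" "0 \<le> p" "p \<le> 1"
  shows "(\<lambda>t. t powr (a - 1) * (1 - t) powr (b - 1)) integrable_on {0..p::real}"
  by (rule integrable_subinterval_real[OF has_integral_integrable[OF has_integral_Beta_real[OF assms(1,2)]]])
     (use assms in auto)

lemma inc_beta_nonneg:
  assumes "a > 0" "b > 0" "0 \<le> p" "p \<le> 1"
  shows "inc_beta p a b \<ge> 0"
  unfolding inc_beta_def by (rule integral_nonneg[OF inc_beta_integrable[OF assms]]) simp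

lemma reg_inc_beta_nonneg:
  assumes "a > 0" "b > 0" "0 \<le> p" "p \<le> 1"
  shows "reg_inc_beta p a b \<ge> 0"
  unfolding reg_inc_beta_def using assms by (simp add: inc_beta_nonneg)

lemma reg_inc_beta_1:
  assumes "a > 0" "b > 0"
  shows "reg_inc_beta 1 a b = 1"
proof -
  have "Beta a b > 0" using assms by (simp add: Beta_def Gamma_real_pos)
  then show ?thesis unfolding reg_inc_beta_def inc_beta_1[OF assms] by simp
qed

text \<open>
  The factorisation behind the independence of sum and ratio of two gamma variables: at \<open>x = s t\<close> the
  integrand of the convolution splits into the Gamma\<open>(a + b)\<close> density at \<open>s\<close> times the Beta\<open>(a, b)\<close> density
  at \<open>t\<close>, cut off at \<open>p\<close>.  The equation also holds outside \<open>0 < t < 1\<close>: both sides vanish there, using \<open>0 powr c = 0\<close>.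
\<close>
lemma gamma_density_product_scaled:
  assumes "a > 0" "b > 0" "0 \<le> p" "p \<le> 1" "s > 0"
  shows "s * (gamma_density a (s * t) * gamma_density b (s - s * t) * indicator {..p * s} (s * t))
      = gamma_density (a + b) s / Beta a b *
         (t powr (a - 1) * (1 - t) powr (b - 1) * indicator {0..p} t)"
proof (cases "0 < t \<and> t < 1")
  case True
  have G: "Gamma a \<noteq> 0" "Gamma b \<noteq> 0" "Gamma (a + b) \<noteq> 0"
    using assms by (auto intro!: less_imp_neq[THEN not_sym] Gamma_real_pos simp del: Gamma_real_pos)
  have t: "s - s * t = s * (1 - t)" by (simp add: algebra_simps)
  have ind: "indicator {..p * s} (s * t) = (indicator {0..p} t :: real)"
    using True assms by (auto simp: indicator_def mult.commute)
  have e: "exp (- s) = exp (- (s * t)) * exp (- (s * (1 - t)))"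
    by (simp add: exp_add [symmetric] algebra_simps)
  have pw: "s powr (a + b - 1) = s * s powr (a - 1) * s powr (b - 1)"
    using assms by (simp add: powr_add [symmetric] powr_mult_base algebra_simps)
  have "s * (gamma_density a (s * t) * gamma_density b (s * (1 - t)))
      = gamma_density (a + b) s / Beta a b * (t powr (a - 1) * (1 - t) powr (b - 1))"
    using True assms G unfolding gamma_density_def Beta_def e pw powr_mult
    by (auto simp: divide_simps powr_mult)
  then show ?thesis unfolding ind t by (simp add: indicator_def)
next
  case False
  then consider "t \<le> 0" | "t \<ge> 1" by linarith
  then show ?thesis
  proof cases
    case 1
    then have "\<not> s * t > 0" using assms by (simp add: zero_less_mult_iff)
    moreover have "t powr (a - 1) * indicator {0..p} t = 0" using 1 by (auto simp: indicator_def)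
    ultimately show ?thesis by (auto simp: gamma_density_def)
  next
    case 2
    then have "\<not> s - s * t > 0" using assms by simp
    moreover have "(1 - t) powr (b - 1) * indicator {0..p} t = 0" using 2 assms by (auto simp: indicator_def)
    ultimately show ?thesis by (auto simp: gamma_density_def)
  qed
qed

text \<open>
  The part of the convolution integral in which the first summand makes up at most the fraction \<open>p\<close> of
  the total.  The case \<open>p = 1\<close> is the semigroup law of the gamma densities, and general \<open>p\<close>
  yields the distribution of the ratio.
\<close>
lemma nn_integral_gamma_density_product:
  assumes "a > 0" "b > 0" "0 \<le> p" "p \<le> 1"
  shows "(\<integral>\<^sup>+x. ennreal (gamma_density a x * gamma_density b (s - x)) * indicator {..p * s} x \<partial>lborel)
    = ennreal (reg_inc_beta p a b * gamma_density (a + b) s)"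
proof (cases "s > 0")
  case False
  then have "(\<integral>\<^sup>+x. ennreal (gamma_density a x * gamma_density b (s - x)) * indicator {..p * s} x \<partial>lborel)
      = (\<integral>\<^sup>+x. 0 \<partial>(lborel :: real measure))"
    by (intro nn_integral_cong) (auto simp: gamma_density_def)
  then show ?thesis using False by (simp add: gamma_density_def)
next
  case True
  let ?K = "gamma_density (a + b) s / Beta a b"
  have K: "?K \<ge> 0" using assms by (simp add: gamma_density_nonneg Beta_def Gamma_real_pos less_imp_le)
  have "(\<integral>\<^sup>+x. ennreal (gamma_density a x * gamma_density b (s - x)) * indicator {..p * s} x \<partial>lborel)
      = (\<integral>\<^sup>+t. ennreal (s * (gamma_density a (s * t) * gamma_density b (s - s * t)
             * indicator {..p * s} (s * t))) \<partial>lborel)"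
    using True
    by (subst nn_integral_real_affine[where c = s and t = 0])
       (auto simp: nn_integral_cmult[symmetric] ennreal_mult' ennreal_indicator[symmetric]
          ennreal_mult''[symmetric] simp del: ennreal_indicator intro!: nn_integral_cong)
  also have "\<dots> = (\<integral>\<^sup>+t. ennreal ?K * (ennreal (t powr (a - 1) * (1 - t) powr (b - 1)) * indicator {0..p} t) \<partial>lborel)"
    unfolding gamma_density_product_scaled[OF assms True]
    using K by (intro nn_integral_cong) (auto simp: ennreal_mult'[symmetric] split: split_indicator)
  also have "\<dots> = ennreal ?K * (\<integral>\<^sup>+t. ennreal (t powr (a - 1) * (1 - t) powr (b - 1)) * indicator {0..p} t \<partial>lborel)"
    by (rule nn_integral_cmult) simp
  also have "(\<integral>\<^sup>+t. ennreal (t powr (a - 1) * (1 - t) powr (b - 1)) * indicator {0..p} t \<partial>lborel)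
       = ennreal (inc_beta p a b)"
    unfolding inc_beta_def
    by (rule nn_integral_has_integral_lebesgue'[OF _ integrable_integral[OF inc_beta_integrable[OF assms]]]) simp
  also have "ennreal ?K * ennreal (inc_beta p a b) = ennreal (reg_inc_beta p a b * gamma_density (a + b) s)"
    using K inc_beta_nonneg[OF assms] assms
    by (simp add: ennreal_mult'[symmetric] reg_inc_beta_def inc_beta_1 mult.commute)
  finally show ?thesis .
qed

lemma gamma_density_convolution:
  assumes "a > 0" "b > 0"
  shows "(\<integral>\<^sup>+y. ennreal (gamma_density a (s - y)) * ennreal (gamma_density b y) \<partial>lborel)
    = ennreal (gamma_density (a + b) s)"
proof -
  have "(\<integral>\<^sup>+y. ennreal (gamma_density a (s - y)) * ennreal (gamma_density b y) \<partial>lborel)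
      = (\<integral>\<^sup>+y. ennreal (gamma_density b y * gamma_density a (s - y)) * indicator {..1 * s} y \<partial>lborel)"
    using assms
    by (intro nn_integral_cong)
       (auto simp: gamma_density_nonneg gamma_density_def ennreal_mult'[symmetric] mult.commute split: split_indicator)
  also have "\<dots> = ennreal (gamma_density (a + b) s)"
    by (subst nn_integral_gamma_density_product) (use assms in \<open>auto simp: reg_inc_beta_1 add.commute\<close>)
  finally show ?thesis .
qed

lemma nn_integral_gamma_density:
  assumes "a > 0"
  shows "(\<integral>\<^sup>+x. ennreal (gamma_density a x) \<partial>lborel) = 1"
proof -
  have G: "Gamma a > 0" using assms by (rule Gamma_real_pos)
  have "(\<integral>\<^sup>+x. ennreal (gamma_density a x) \<partial>lborel)
      = (\<integral>\<^sup>+x. ennreal (1 / Gamma a) * (ennreal (x powr (a - 1) / exp x) * indicator {0..} x) \<partial>lborel)"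
    using G by (intro nn_integral_cong)
      (auto simp: gamma_density_def ennreal_mult'[symmetric] exp_minus field_simps split: split_indicator)
  also have "\<dots> = ennreal (1 / Gamma a) * (\<integral>\<^sup>+x. ennreal (x powr (a - 1) / exp x) * indicator {0..} x \<partial>lborel)"
    by (rule nn_integral_cmult) simp
  also have "(\<integral>\<^sup>+x. ennreal (x powr (a - 1) / exp x) * indicator {0..} x \<partial>lborel) = ennreal (Gamma a)"
    by (rule nn_integral_has_integral_lebesgue'[OF _ Gamma_integral_real[OF assms]]) simp
  also have "ennreal (1 / Gamma a) * ennreal (Gamma a) = 1"
    using G by (simp add: ennreal_mult'[symmetric])
  finally show ?thesis .
qed

text \<open>
  For independent \<open>A\<close>, \<open>B\<close> with Gamma\<open>(a)\<close> and Gamma\<open>(b)\<close> laws, \<open>(1 - p) A - p B \<le> 0\<close> says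
  \<open>A \<le> p (A + B)\<close>; substituting the total \<open>s = x + y\<close> for \<open>y\<close> reduces the integral
  to \<open>nn_integral_gamma_density_product\<close>.
\<close>
lemma gamma_ratio_probability:
  assumes "a > 0" "b > 0" "0 \<le> p" "p \<le> 1"
  shows "(\<integral>\<^sup>+x. \<integral>\<^sup>+y. ennreal (gamma_density a x) * (ennreal (gamma_density b y) *
            indicator {..0} ((1 - p) * x - p * y)) \<partial>lborel \<partial>lborel)
    = ennreal (reg_inc_beta p a b)"
proof -
  have "(\<integral>\<^sup>+x. \<integral>\<^sup>+y. ennreal (gamma_density a x) * (ennreal (gamma_density b y) *
            indicator {..0} ((1 - p) * x - p * y)) \<partial>lborel \<partial>lborel)
      = (\<integral>\<^sup>+x. \<integral>\<^sup>+s. ennreal (gamma_density a x * gamma_density b (s - x)) * indicator {..p * s} x \<partial>lborel \<partial>lborel)"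
  proof (rule nn_integral_cong)
    fix x :: real
    show "(\<integral>\<^sup>+y. ennreal (gamma_density a x) * (ennreal (gamma_density b y) *
            indicator {..0} ((1 - p) * x - p * y)) \<partial>lborel)
        = (\<integral>\<^sup>+s. ennreal (gamma_density a x * gamma_density b (s - x)) * indicator {..p * s} x \<partial>lborel)"
      by (subst nn_integral_real_affine[where c = 1 and t = "- x"])
         (use assms in \<open>auto intro!: nn_integral_cong simp: gamma_density_nonneg ennreal_mult'
            algebra_simps split: split_indicator\<close>)
  qed
  also have "\<dots> = (\<integral>\<^sup>+s. \<integral>\<^sup>+x. ennreal (gamma_density a x * gamma_density b (s - x)) * indicator {..p * s} x \<partial>lborel \<partial>lborel)"
    by (rule lborel_pair.Fubini') (simp add: case_prod_unfold indicator_def of_bool_def)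
  also have "\<dots> = (\<integral>\<^sup>+s. ennreal (reg_inc_beta p a b) * ennreal (gamma_density (a + b) s) \<partial>lborel)"
    unfolding nn_integral_gamma_density_product[OF assms]
    using reg_inc_beta_nonneg[OF assms] by (simp add: ennreal_mult')
  also have "\<dots> = ennreal (reg_inc_beta p a b)"
    using assms by (subst nn_integral_cmult) (simp_all add: nn_integral_gamma_density)
  finally show ?thesis .
qed

section \<open>Noncentral gamma laws\<close>

definition poisson_weight :: "real \<Rightarrow> nat \<Rightarrow> real" where
  "poisson_weight l j = exp (- l) * l ^ j / fact j"

text \<open>
  The Poisson\<open>(l)\<close> mixture of the densities of Gamma\<open>(a + j)\<close>: twice a variable with this law is noncentral
  chi-squared with \<open>2 a\<close> degrees of freedom and noncentrality \<open>2 l\<close>.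
\<close>
definition nc_gamma_density :: "real \<Rightarrow> real \<Rightarrow> real \<Rightarrow> ennreal" where
  "nc_gamma_density a l x = (\<Sum>j. ennreal (poisson_weight l j) * ennreal (gamma_density (a + real j) x))"

definition nc_gamma :: "real \<Rightarrow> real \<Rightarrow> real measure" where
  "nc_gamma a l = density lborel (nc_gamma_density a l)"

lemma poisson_weight_nonneg: "l \<ge> 0 \<Longrightarrow> poisson_weight l j \<ge> 0"
  by (simp add: poisson_weight_def)

lemma borel_measurable_nc_gamma_density [measurable]:
  "nc_gamma_density a l \<in> borel_measurable borel"
  unfolding nc_gamma_density_def[abs_def] by measurable

lemma sets_nc_gamma [measurable_cong, simp]: "sets (nc_gamma a l) = sets borel"
  by (simp add: nc_gamma_def)

lemma space_nc_gamma [simp]: "space (nc_gamma a l) = UNIV"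
  by (simp add: nc_gamma_def)

lemma suminf_poisson_weight: "l \<ge> 0 \<Longrightarrow> (\<Sum>j. ennreal (poisson_weight l j)) = 1"
proof -
  assume l: "l \<ge> 0"
  have "(\<lambda>j. exp (- l) * (l ^ j /\<^sub>R fact j)) sums (exp (- l) * exp l)"
    by (intro sums_mult exp_converges)
  then have "poisson_weight l sums 1"
    by (simp add: poisson_weight_def[abs_def] exp_minus field_simps)
  then have "(\<Sum>j. ennreal (poisson_weight l j)) = ennreal 1"
    by (rule suminf_ennreal_eq[OF poisson_weight_nonneg[OF l]])
  then show ?thesis by simp
qed

lemma suminf_ennreal_diagonals:
  fixes F :: "nat \<Rightarrow> nat \<Rightarrow> ennreal"
  shows "(\<Sum>j. \<Sum>k. F j k) = (\<Sum>i. \<Sum>j\<le>i. F j (i - j))"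
proof -
  have "(\<Sum>j. \<Sum>k. F j k) = (\<Sum>j. \<Sum>i. if j \<le> i then F j (i - j) else 0)"
  proof (rule suminf_cong)
    fix j
    have "(\<Sum>i. if j \<le> i then F j (i - j) else 0)
        = (\<Sum>i. if j \<le> i + j then F j (i + j - j) else 0) + (\<Sum>i<j. if j \<le> i then F j (i - j) else 0)"
      by (rule suminf_offset) simp
    then show "(\<Sum>k. F j k) = (\<Sum>i. if j \<le> i then F j (i - j) else 0)" by simp
  qed
  \<comment> \<open>Tonelli, one of the two sums being read as an integral over the counting measure.\<close>
  also have "\<dots> = (\<Sum>i. \<Sum>j. if j \<le> i then F j (i - j) else 0)"
    unfolding nn_integral_count_space_nat[symmetric]
    by (rule nn_integral_suminf[where M = "count_space UNIV", unfolded nn_integral_count_space_nat[symmetric]]) simp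
  also have "\<dots> = (\<Sum>i. \<Sum>j\<le>i. F j (i - j))"
  proof (rule suminf_cong)
    fix i
    show "(\<Sum>j. if j \<le> i then F j (i - j) else 0) = (\<Sum>j\<le>i. F j (i - j))"
      by (subst suminf_finite[of "{..i}"]) auto
  qed
  finally show ?thesis .
qed

lemma poisson_weight_convolution:
  "(\<Sum>j\<le>i. poisson_weight l j * poisson_weight m (i - j)) = poisson_weight (l + m) i"
proof -
  have "(\<Sum>j\<le>i. poisson_weight l j * poisson_weight m (i - j))
      = (\<Sum>j\<le>i. exp (- (l + m)) / fact i * (of_nat (i choose j) * l ^ j * m ^ (i - j)))"
    by (intro sum.cong refl)
       (simp add: poisson_weight_def binomial_fact exp_add[symmetric] field_simps)
  also have "\<dots> = poisson_weight (l + m) i"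
    unfolding sum_distrib_left[symmetric] by (simp add: binomial_ring poisson_weight_def)
  finally show ?thesis .
qed

text \<open>
  If \<open>J\<close>, \<open>K\<close> are independent Poisson variables, this is the statement that \<open>J + K\<close> is again Poisson,
  written with a test function \<open>h\<close>; it merges the two mixture indices when mixtures are convolved.
\<close>
lemma suminf_poisson_weight_convolution:
  fixes h :: "nat \<Rightarrow> ennreal"
  assumes "l \<ge> 0" "m \<ge> 0"
  shows "(\<Sum>j. \<Sum>k. ennreal (poisson_weight l j) * (ennreal (poisson_weight m k) * h (j + k)))
     = (\<Sum>i. ennreal (poisson_weight (l + m) i) * h i)"
proof -
  have "(\<Sum>j\<le>i. ennreal (poisson_weight l j) * (ennreal (poisson_weight m (i - j)) * h (j + (i - j))))
      = ennreal (poisson_weight (l + m) i) * h i" for i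
  proof -
    have "(\<Sum>j\<le>i. ennreal (poisson_weight l j) * (ennreal (poisson_weight m (i - j)) * h (j + (i - j))))
        = (\<Sum>j\<le>i. ennreal (poisson_weight l j * poisson_weight m (i - j))) * h i"
      unfolding sum_distrib_right
      by (intro sum.cong refl) (use assms in \<open>auto simp: poisson_weight_nonneg ennreal_mult' mult_ac\<close>)
    also have "(\<Sum>j\<le>i. ennreal (poisson_weight l j * poisson_weight m (i - j)))
        = ennreal (poisson_weight (l + m) i)"
      using assms by (simp add: poisson_weight_nonneg poisson_weight_convolution)
    finally show ?thesis .
  qed
  then show ?thesis by (subst suminf_ennreal_diagonals) simp
qed

lemma nn_integral_nc_gamma:
  assumes [measurable]: "F \<in> borel_measurable borel"
  shows "(\<integral>\<^sup>+x. F x \<partial>nc_gamma a l)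
    = (\<Sum>j. ennreal (poisson_weight l j) * (\<integral>\<^sup>+x. ennreal (gamma_density (a + real j) x) * F x \<partial>lborel))"
proof -
  have "(\<integral>\<^sup>+x. F x \<partial>nc_gamma a l)
      = (\<integral>\<^sup>+x. (\<Sum>j. ennreal (poisson_weight l j) * (ennreal (gamma_density (a + real j) x) * F x)) \<partial>lborel)"
    unfolding nc_gamma_def
    by (simp add: nn_integral_density nc_gamma_density_def ennreal_suminf_multc[symmetric] mult.assoc)
  also have "\<dots> = (\<Sum>j. ennreal (poisson_weight l j) * (\<integral>\<^sup>+x. ennreal (gamma_density (a + real j) x) * F x \<partial>lborel))"
    by (simp add: nn_integral_suminf nn_integral_cmult)
  finally show ?thesis .
qed

lemma prob_space_nc_gamma:
  assumes "a > 0" "l \<ge> 0"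
  shows "prob_space (nc_gamma a l)"
proof
  have "emeasure (nc_gamma a l) (space (nc_gamma a l)) = (\<integral>\<^sup>+x. 1 \<partial>nc_gamma a l)"
    by simp
  also have "\<dots> = 1"
    by (subst nn_integral_nc_gamma)
       (use assms in \<open>auto simp: nn_integral_gamma_density suminf_poisson_weight add_pos_nonneg\<close>)
  finally show "emeasure (nc_gamma a l) (space (nc_gamma a l)) = 1" .
qed

lemma nc_gamma_density_convolution:
  assumes "a > 0" "b > 0" "l \<ge> 0" "m \<ge> 0"
  shows "(\<integral>\<^sup>+y. nc_gamma_density a l (s - y) * nc_gamma_density b m y \<partial>lborel)
    = nc_gamma_density (a + b) (l + m) s"
proof -
  have "(\<integral>\<^sup>+y. nc_gamma_density a l (s - y) * nc_gamma_density b m y \<partial>lborel)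
    = (\<integral>\<^sup>+y. (\<Sum>j. \<Sum>k. ennreal (poisson_weight l j) * (ennreal (poisson_weight m k) *
        (ennreal (gamma_density (a + real j) (s - y)) * ennreal (gamma_density (b + real k) y)))) \<partial>lborel)"
    unfolding nc_gamma_density_def ennreal_suminf_multc[symmetric]
    unfolding ennreal_suminf_cmult[symmetric] by (simp only: mult_ac)
  also have "\<dots> = (\<Sum>j. \<Sum>k. ennreal (poisson_weight l j) * (ennreal (poisson_weight m k) *
      (\<integral>\<^sup>+y. ennreal (gamma_density (a + real j) (s - y)) * ennreal (gamma_density (b + real k) y) \<partial>lborel)))"
    by (simp add: nn_integral_suminf nn_integral_cmult)
  also have "\<dots> = (\<Sum>j. \<Sum>k. ennreal (poisson_weight l j) * (ennreal (poisson_weight m k) *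
      ennreal (gamma_density (a + b + real (j + k)) s)))"
    using assms by (subst gamma_density_convolution) (auto simp: add_pos_nonneg algebra_simps)
  also have "\<dots> = nc_gamma_density (a + b) (l + m) s"
    using assms by (subst suminf_poisson_weight_convolution) (auto simp: nc_gamma_density_def)
  finally show ?thesis .
qed

lemma nc_gamma_convolution:
  assumes "a > 0" "b > 0" "l \<ge> 0" "m \<ge> 0"
  shows "nc_gamma a l \<star> nc_gamma b m = nc_gamma (a + b) (l + m)"
proof -
  interpret A: prob_space "nc_gamma a l" by (rule prob_space_nc_gamma) fact+
  interpret B: prob_space "nc_gamma b m" by (rule prob_space_nc_gamma) fact+
  have "finite_measure (nc_gamma a l)" "finite_measure (nc_gamma b m)" by unfold_locales
  then have "nc_gamma a l \<star> nc_gamma b m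
    = density lborel (\<lambda>s. \<integral>\<^sup>+y. nc_gamma_density a l (s - y) * nc_gamma_density b m y \<partial>lborel)"
    unfolding nc_gamma_def by (intro convolution_density) auto
  also have "\<dots> = nc_gamma (a + b) (l + m)"
    unfolding nc_gamma_density_convolution[OF assms] nc_gamma_def ..
  finally show ?thesis .
qed

text \<open>
  Conditioning on the two Poisson indices reduces the noncentral ratio to \<open>gamma_ratio_probability\<close>.
\<close>
lemma nc_gamma_ratio_probability:
  assumes "a > 0" "b > 0" "l \<ge> 0" "m \<ge> 0" "0 \<le> p" "p \<le> 1"
  shows "(\<integral>\<^sup>+x. \<integral>\<^sup>+y. indicator {..0} ((1 - p) * x - p * y) \<partial>nc_gamma b m \<partial>nc_gamma a l)
    = (\<Sum>j. \<Sum>k. ennreal (poisson_weight l j * poisson_weight m k * reg_inc_beta p (a + real j) (b + real k)))"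
proof -
  interpret B: prob_space "nc_gamma b m" by (rule prob_space_nc_gamma) fact+
  have "(\<integral>\<^sup>+x. \<integral>\<^sup>+y. indicator {..0} ((1 - p) * x - p * y) \<partial>nc_gamma b m \<partial>nc_gamma a l)
    = (\<Sum>j. ennreal (poisson_weight l j) * (\<integral>\<^sup>+x. ennreal (gamma_density (a + real j) x) *
        (\<integral>\<^sup>+y. indicator {..0} ((1 - p) * x - p * y) \<partial>nc_gamma b m) \<partial>lborel))"
    by (rule nn_integral_nc_gamma) measurable
  also have "\<dots> = (\<Sum>j. ennreal (poisson_weight l j) * (\<integral>\<^sup>+x. ennreal (gamma_density (a + real j) x) *
        (\<Sum>k. ennreal (poisson_weight m k) * (\<integral>\<^sup>+y. ennreal (gamma_density (b + real k) y) *
            indicator {..0} ((1 - p) * x - p * y) \<partial>lborel)) \<partial>lborel))"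
    by (subst nn_integral_nc_gamma) auto
  also have "\<dots> = (\<Sum>j. ennreal (poisson_weight l j) * (\<Sum>k. ennreal (poisson_weight m k) *
        (\<integral>\<^sup>+x. \<integral>\<^sup>+y. ennreal (gamma_density (a + real j) x) * (ennreal (gamma_density (b + real k) y) *
            indicator {..0} ((1 - p) * x - p * y)) \<partial>lborel \<partial>lborel)))"
  proof (intro suminf_cong arg_cong2[where f = "(*)"] refl)
    fix j
    let ?I = "\<lambda>k x. \<integral>\<^sup>+y. ennreal (gamma_density (b + real k) y) * indicator {..0} ((1 - p) * x - p * y) \<partial>lborel"
    have "(\<integral>\<^sup>+x. ennreal (gamma_density (a + real j) x) * (\<Sum>k. ennreal (poisson_weight m k) * ?I k x) \<partial>lborel)
        = (\<integral>\<^sup>+x. (\<Sum>k. ennreal (poisson_weight m k) * (ennreal (gamma_density (a + real j) x) * ?I k x)) \<partial>lborel)"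
      unfolding ennreal_suminf_cmult[symmetric] by (simp only: mult.left_commute)
    also have "\<dots> = (\<Sum>k. ennreal (poisson_weight m k) * (\<integral>\<^sup>+x. ennreal (gamma_density (a + real j) x) * ?I k x \<partial>lborel))"
      by (simp add: nn_integral_suminf nn_integral_cmult)
    also have "\<dots> = (\<Sum>k. ennreal (poisson_weight m k) *
        (\<integral>\<^sup>+x. \<integral>\<^sup>+y. ennreal (gamma_density (a + real j) x) * (ennreal (gamma_density (b + real k) y) *
            indicator {..0} ((1 - p) * x - p * y)) \<partial>lborel \<partial>lborel))"
      by (simp add: nn_integral_cmult)
    finally show "(\<integral>\<^sup>+x. ennreal (gamma_density (a + real j) x) * (\<Sum>k. ennreal (poisson_weight m k) * ?I k x) \<partial>lborel)
        = (\<Sum>k. ennreal (poisson_weight m k) *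
        (\<integral>\<^sup>+x. \<integral>\<^sup>+y. ennreal (gamma_density (a + real j) x) * (ennreal (gamma_density (b + real k) y) *
            indicator {..0} ((1 - p) * x - p * y)) \<partial>lborel \<partial>lborel))" .
  qed
  also have "\<dots> = (\<Sum>j. ennreal (poisson_weight l j) * (\<Sum>k. ennreal (poisson_weight m k) *
        ennreal (reg_inc_beta p (a + real j) (b + real k))))"
    using assms by (simp add: gamma_ratio_probability add_pos_nonneg)
  also have "\<dots> = (\<Sum>j. \<Sum>k. ennreal (poisson_weight l j * poisson_weight m k * reg_inc_beta p (a + real j) (b + real k)))"
    unfolding ennreal_suminf_cmult[symmetric]
    using assms by (intro suminf_cong)
      (simp add: add_pos_nonneg ennreal_mult' poisson_weight_nonneg reg_inc_beta_nonneg mult.assoc)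
  finally show ?thesis .
qed

section \<open>The square of a normal variable\<close>

lemma Gamma_half_plus_nat:
  "Gamma (1 / 2 + real j) = sqrt pi * fact (2 * j) / (4 ^ j * fact j)"
proof -
  have "(1 / 2 :: real) \<notin> \<int>\<^sub>\<le>\<^sub>0" by (auto elim!: nonpos_Ints_cases)
  then have "Gamma (1 / 2 + real j) = sqrt pi * pochhammer (1 / 2) j"
    by (simp add: pochhammer_Gamma Gamma_one_half_real)
  then show ?thesis by (simp add: fact_double power_mult)
qed

lemma cosh_sums_even: "(\<lambda>j. x ^ (2 * j) / fact (2 * j)) sums cosh (x :: real)"
proof -
  have "strict_mono (\<lambda>j::nat. 2 * j)" by (auto simp: strict_mono_def)
  then have "(\<lambda>j. if even (2 * j) then x ^ (2 * j) /\<^sub>R fact (2 * j) else 0) sums cosh x"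
    by (subst sums_mono_reindex[where g = "\<lambda>j. 2 * j"]) (auto simp: cosh_converges elim!: evenE)
  then show ?thesis by (simp add: field_simps)
qed

text \<open>
  The Poisson mixture of the densities Gamma\<open>(1/2 + j)\<close>, evaluated at \<open>u\<^sup>2/2\<close>, is the power series of
  \<open>cosh (m u)\<close> up to a factor, because \<open>j! \<Gamma>(1/2 + j) = sqrt \<pi> (2j)! / 4\<^sup>j\<close>.  The two exponentials in
  \<open>cosh\<close> are the contributions of the two square roots \<open>u\<close> and \<open>-u\<close>.
\<close>
lemma nc_gamma_density_half:
  assumes "u > 0"
  shows "nc_gamma_density (1 / 2) (m\<^sup>2 / 2) (u\<^sup>2 / 2)
    = ennreal ((normal_density m 1 u + normal_density (- m) 1 u) / u)"
proof -
  let ?C = "exp (- (m\<^sup>2 / 2) - u\<^sup>2 / 2) * sqrt 2 / (sqrt pi * u)"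
  have term_eq: "poisson_weight (m\<^sup>2 / 2) j * gamma_density (1 / 2 + real j) (u\<^sup>2 / 2)
      = ?C * ((m * u) ^ (2 * j) / fact (2 * j))" for j
  proof -
    have "(u\<^sup>2 / 2) powr (1 / 2 + real j - 1) = (u\<^sup>2 / 2) powr (real j - 1 / 2)" by (simp add: algebra_simps)
    also have "\<dots> = (u\<^sup>2 / 2) ^ j / sqrt (u\<^sup>2 / 2)"
      using assms by (subst powr_diff) (simp add: powr_realpow powr_half_sqrt)
    also have "\<dots> = (u\<^sup>2 / 2) ^ j * sqrt 2 / u"
      using assms by (simp add: real_sqrt_divide)
    finally have pw: "(u\<^sup>2 / 2) powr (1 / 2 + real j - 1) = (u\<^sup>2 / 2) ^ j * sqrt 2 / u" .
    have four: "(4::real) ^ j = 2 ^ j * 2 ^ j"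
      unfolding power_mult_distrib[symmetric] by simp
    have mu: "(m * u) ^ (2 * j) = (m\<^sup>2) ^ j * (u\<^sup>2) ^ j"
      unfolding power_mult power_mult_distrib ..
    have ee: "exp (- (m\<^sup>2 / 2) - u\<^sup>2 / 2) = exp (- (m\<^sup>2 / 2)) * exp (- (u\<^sup>2 / 2))"
      by (simp add: exp_add[symmetric])
    show ?thesis unfolding mu ee poisson_weight_def gamma_density_def pw Gamma_half_plus_nat
      using assms by (simp add: power_divide four divide_simps)
  qed
  have "(\<lambda>j. poisson_weight (m\<^sup>2 / 2) j * gamma_density (1 / 2 + real j) (u\<^sup>2 / 2)) sums (?C * cosh (m * u))"
    unfolding term_eq by (intro sums_mult cosh_sums_even)
  moreover have "?C * cosh (m * u) = (normal_density m 1 u + normal_density (- m) 1 u) / u"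
  proof -
    have "exp (- (u - m)\<^sup>2 / 2) = exp (- (m\<^sup>2 / 2) - u\<^sup>2 / 2) * exp (m * u)"
         "exp (- (u + m)\<^sup>2 / 2) = exp (- (m\<^sup>2 / 2) - u\<^sup>2 / 2) * exp (- (m * u))"
      by (simp_all add: exp_add[symmetric] power2_eq_square field_simps)
    then have N: "normal_density m 1 u + normal_density (- m) 1 u
        = exp (- (m\<^sup>2 / 2) - u\<^sup>2 / 2) * (exp (m * u) + exp (- (m * u))) * (1 / sqrt 2) / sqrt pi"
      by (simp add: normal_density_def real_sqrt_mult add_divide_distrib distrib_left)
    have half: "1 / sqrt 2 = sqrt 2 / (2::real)"
      using sqrt_divide_self_eq[of 2] by (simp add: inverse_eq_divide)
    show ?thesis
      unfolding N half using assms by (simp add: cosh_def mult_ac)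
  qed
  ultimately have s: "(\<lambda>j. poisson_weight (m\<^sup>2 / 2) j * gamma_density (1 / 2 + real j) (u\<^sup>2 / 2))
      sums ((normal_density m 1 u + normal_density (- m) 1 u) / u)" by simp
  have "(\<Sum>j. ennreal (poisson_weight (m\<^sup>2 / 2) j * gamma_density (1 / 2 + real j) (u\<^sup>2 / 2)))
      = ennreal ((normal_density m 1 u + normal_density (- m) 1 u) / u)"
    by (rule suminf_ennreal_eq[OF _ s]) (simp add: poisson_weight_nonneg gamma_density_nonneg add_pos_nonneg)
  then show ?thesis
    unfolding nc_gamma_density_def by (simp add: ennreal_mult' poisson_weight_nonneg)
qed

lemma nc_gamma_density_nonpos: "x \<le> 0 \<Longrightarrow> nc_gamma_density a l x = 0"
  by (simp add: nc_gamma_density_def gamma_density_def)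

text \<open>
  Both sides become integrals over \<open>[0, b]\<close>: on the left substitute \<open>y = u\<^sup>2/2\<close>, which by the previous lemmas
  turns the density into \<open>\<phi>(u - m) + \<phi>(u + m)\<close>; on the right fold the negative half of \<open>[-b, b]\<close> over.
\<close>
lemma emeasure_nc_gamma_half_atMost:
  assumes "b \<ge> 0"
  shows "emeasure (nc_gamma (1 / 2) (m\<^sup>2 / 2)) {..b\<^sup>2 / 2}
    = (\<integral>\<^sup>+u. ennreal (normal_density m 1 u) * indicator {-b..b} u \<partial>lborel)"
proof -
  \<comment> \<open>The density in real-valued closed form, for the substitution rule.\<close>
  define f where "f y = (if y > 0 then (normal_density m 1 (sqrt (2 * y)) + normal_density (- m) 1 (sqrt (2 * y)))
      / sqrt (2 * y) else 0)" for y
  have f[measurable]: "f \<in> borel_measurable borel" unfolding f_def[abs_def] by measurable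
  have f_eq: "nc_gamma_density (1 / 2) (m\<^sup>2 / 2) y = ennreal (f y)" for y
  proof (cases "y > 0")
    case True
    then show ?thesis using nc_gamma_density_half[of "sqrt (2 * y)" m] by (simp add: f_def)
  qed (simp add: f_def nc_gamma_density_nonpos)
  have f_half: "ennreal (f (u\<^sup>2 / 2)) * ennreal u = ennreal (normal_density m 1 u) + ennreal (normal_density (- m) 1 u)"
    if "u > 0" for u
    using that by (simp add: f_def ennreal_mult''[symmetric] ennreal_plus[symmetric] del: ennreal_plus)
  have "emeasure (nc_gamma (1 / 2) (m\<^sup>2 / 2)) {..b\<^sup>2 / 2}
      = (\<integral>\<^sup>+y. ennreal (f y) * indicator {0\<^sup>2 / 2..b\<^sup>2 / 2} y \<partial>lborel)"
    by (simp add: nc_gamma_def emeasure_density f_eq) (auto intro!: nn_integral_cong simp: f_def split: split_indicator)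
  also have "\<dots> = (\<integral>\<^sup>+u. ennreal (f (u\<^sup>2 / 2)) * ennreal u * indicator {0..b} u \<partial>lborel)"
  proof -
    have "(\<integral>\<^sup>+y. ennreal (f y * indicator {0\<^sup>2 / 2..b\<^sup>2 / 2} y) \<partial>lborel)
        = (\<integral>\<^sup>+u. ennreal (f (u\<^sup>2 / 2) * u * indicator {0..b} u) \<partial>lborel)"
      by (rule nn_integral_substitution[where g = "\<lambda>u. u\<^sup>2 / 2" and g' = "\<lambda>u. u"])
         (use assms in \<open>auto intro!: derivative_eq_intros continuous_intros simp: set_borel_measurable_def\<close>)
    moreover have "f y \<ge> 0" for y by (simp add: f_def)
    ultimately show ?thesis
      by (simp add: ennreal_mult' ennreal_mult'' ennreal_indicator[symmetric] del: ennreal_indicator)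
  qed
  \<comment> \<open>The closed form of the integrand fails at \<open>u = 0\<close>, a null set.\<close>
  also have "\<dots> = (\<integral>\<^sup>+u. ennreal (normal_density m 1 u) * indicator {0..b} u
       + ennreal (normal_density (- m) 1 u) * indicator {0..b} u \<partial>lborel)"
    using AE_lborel_singleton[of 0]
    by (intro nn_integral_cong_AE) (auto simp: f_half split: split_indicator)
  also have "\<dots> = (\<integral>\<^sup>+u. ennreal (normal_density m 1 u) * indicator {0..b} u \<partial>lborel)
       + (\<integral>\<^sup>+u. ennreal (normal_density (- m) 1 u) * indicator {0..b} u \<partial>lborel)"
    by (rule nn_integral_add) auto
  also have "(\<integral>\<^sup>+u. ennreal (normal_density (- m) 1 u) * indicator {0..b} u \<partial>lborel)
      = (\<integral>\<^sup>+u. ennreal (normal_density m 1 u) * indicator {-b..0} u \<partial>lborel)"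
    by (subst nn_integral_real_affine[where c = "-1" and t = 0])
       (auto intro!: nn_integral_cong simp: normal_density_def power2_eq_square algebra_simps split: split_indicator)
  also have "(\<integral>\<^sup>+u. ennreal (normal_density m 1 u) * indicator {0..b} u \<partial>lborel)
      + (\<integral>\<^sup>+u. ennreal (normal_density m 1 u) * indicator {-b..0} u \<partial>lborel)
      = (\<integral>\<^sup>+u. ennreal (normal_density m 1 u) * indicator {0..b} u
         + ennreal (normal_density m 1 u) * indicator {-b..0} u \<partial>lborel)"
    by (rule nn_integral_add[symmetric]) auto
  also have "\<dots> = (\<integral>\<^sup>+u. ennreal (normal_density m 1 u) * indicator {-b..b} u \<partial>lborel)"
    using AE_lborel_singleton[of 0] assms
    by (intro nn_integral_cong_AE) (auto split: split_indicator)
  finally show ?thesis .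
qed

text \<open>
  The distribution functions agree: for \<open>x \<ge> 0\<close> the event \<open>u\<^sup>2/2 \<le> x\<close> is the interval between \<open>\<plusminus>sqrt (2 x)\<close>, and
  neither law charges the negative half-line.
\<close>
lemma distr_half_square_normal:
  "distr (density lborel (normal_density m 1)) borel (\<lambda>u. u\<^sup>2 / 2) = nc_gamma (1 / 2) (m\<^sup>2 / 2)"
    (is "distr ?N _ _ = ?G")
proof (rule cdf_unique)
  interpret N: prob_space ?N by (rule prob_space_normal_density) simp
  interpret G: prob_space ?G by (rule prob_space_nc_gamma) auto
  have "prob_space (distr ?N borel (\<lambda>u. u\<^sup>2 / 2))" by (rule N.prob_space_distr) simp
  then show "real_distribution (distr ?N borel (\<lambda>u. u\<^sup>2 / 2))"
    by (simp add: real_distribution_def real_distribution_axioms_def)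
  show "real_distribution ?G" by unfold_locales simp
  have "emeasure (distr ?N borel (\<lambda>u. u\<^sup>2 / 2)) {..x} = emeasure ?G {..x}" for x
  proof (cases "x \<ge> 0")
    case True
    have "u\<^sup>2 / 2 \<le> x \<longleftrightarrow> - sqrt (2 * x) \<le> u \<and> u \<le> sqrt (2 * x)" for u
    proof -
      have "u\<^sup>2 / 2 \<le> x \<longleftrightarrow> sqrt (u\<^sup>2) \<le> sqrt (2 * x)" unfolding real_sqrt_le_iff by linarith
      then show ?thesis by (simp add: abs_le_iff) linarith
    qed
    then have "(\<lambda>u. u\<^sup>2 / 2) -` {..x} = {-sqrt (2 * x)..sqrt (2 * x)}" by auto
    then have "emeasure (distr ?N borel (\<lambda>u. u\<^sup>2 / 2)) {..x}
        = emeasure ?N {-sqrt (2 * x)..sqrt (2 * x)}"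
      by (subst emeasure_distr) auto
    also have "\<dots> = emeasure ?G {..(sqrt (2 * x))\<^sup>2 / 2}"
      using True by (subst emeasure_nc_gamma_half_atMost) (auto simp: emeasure_density)
    finally show ?thesis using True by simp
  next
    case False
    then have e: "(\<lambda>u. u\<^sup>2 / 2) -` {..x} = {}" by (auto simp: not_le) (smt (verit) zero_le_power2)
    have "emeasure ?G {..x} = (\<integral>\<^sup>+y. nc_gamma_density (1 / 2) (m\<^sup>2 / 2) y * indicator {..x} y \<partial>lborel)"
      unfolding nc_gamma_def by (rule emeasure_density) auto
    also have "\<dots> = (\<integral>\<^sup>+y. 0 \<partial>(lborel :: real measure))"
      using False by (intro nn_integral_cong) (auto simp: nc_gamma_density_nonpos split: split_indicator)
    finally show ?thesis using e by (subst emeasure_distr) auto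
  qed
  then show "cdf (distr ?N borel (\<lambda>u. u\<^sup>2 / 2)) = cdf ?G"
    by (simp add: cdf_def measure_def)
qed

section \<open>Differences of noncentral gamma variables\<close>

text \<open>
  The law of \<open>c A - d B\<close> for independent noncentral gamma variables \<open>A\<close> and \<open>B\<close> of the same shape \<open>a\<close>
  and with Poisson means \<open>l\<close> and \<open>m\<close>.
\<close>
definition nc_gamma_difference :: "real \<Rightarrow> real \<Rightarrow> real \<Rightarrow> real \<Rightarrow> real \<Rightarrow> real measure" where
  "nc_gamma_difference c d a l m = distr (nc_gamma a l \<Otimes>\<^sub>M nc_gamma a m) borel (\<lambda>(s, t). c * s - d * t)"

lemma nn_integral_nc_gamma_difference:
  assumes "a > 0" "l \<ge> 0" "m \<ge> 0" and [measurable]: "F \<in> borel_measurable borel"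
  shows "(\<integral>\<^sup>+z. F z \<partial>nc_gamma_difference c d a l m)
    = (\<integral>\<^sup>+s. \<integral>\<^sup>+t. F (c * s - d * t) \<partial>nc_gamma a m \<partial>nc_gamma a l)"
proof -
  interpret B: prob_space "nc_gamma a m" by (rule prob_space_nc_gamma) fact+
  have "(\<integral>\<^sup>+z. F z \<partial>nc_gamma_difference c d a l m)
      = (\<integral>\<^sup>+p. F (case p of (s, t) \<Rightarrow> c * s - d * t) \<partial>(nc_gamma a l \<Otimes>\<^sub>M nc_gamma a m))"
    unfolding nc_gamma_difference_def by (rule nn_integral_distr) measurable
  also have "\<dots> = (\<integral>\<^sup>+s. \<integral>\<^sup>+t. F (c * s - d * t) \<partial>nc_gamma a m \<partial>nc_gamma a l)"
    by (subst B.nn_integral_fst[symmetric]) auto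
  finally show ?thesis .
qed

lemma sets_nc_gamma_difference [measurable_cong, simp]: "sets (nc_gamma_difference c d a l m) = sets borel"
  by (simp add: nc_gamma_difference_def)

lemma prob_space_nc_gamma_difference:
  assumes "a > 0" "l \<ge> 0" "m \<ge> 0"
  shows "prob_space (nc_gamma_difference c d a l m)"
proof -
  interpret A: prob_space "nc_gamma a l" by (rule prob_space_nc_gamma) fact+
  interpret B: prob_space "nc_gamma a m" by (rule prob_space_nc_gamma) fact+
  interpret P: pair_prob_space "nc_gamma a l" "nc_gamma a m" ..
  show ?thesis unfolding nc_gamma_difference_def by (rule P.prob_space_distr) measurable
qed

text \<open>
  Since \<open>(c A - d B) + (c A' - d B') = c (A + A') - d (B + B')\<close>, it suffices to exchange the order of
  integration over the variables of \<open>B\<close> and \<open>A'\<close> and to convolve the components separately.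
\<close>
lemma nc_gamma_difference_convolution:
  assumes "a > 0" "a' > 0" "l \<ge> 0" "l' \<ge> 0" "m \<ge> 0" "m' \<ge> 0"
  shows "nc_gamma_difference c d a l m \<star> nc_gamma_difference c d a' l' m'
    = nc_gamma_difference c d (a + a') (l + l') (m + m')"
proof (rule measure_eqI)
  interpret A: prob_space "nc_gamma a l" by (rule prob_space_nc_gamma) fact+
  interpret A': prob_space "nc_gamma a' l'" by (rule prob_space_nc_gamma) fact+
  interpret B: prob_space "nc_gamma a m" by (rule prob_space_nc_gamma) fact+
  interpret B': prob_space "nc_gamma a' m'" by (rule prob_space_nc_gamma) fact+
  interpret D: prob_space "nc_gamma_difference c d a l m" by (rule prob_space_nc_gamma_difference) fact+
  interpret D': prob_space "nc_gamma_difference c d a' l' m'" by (rule prob_space_nc_gamma_difference) fact+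
  interpret C: pair_sigma_finite "nc_gamma a m" "nc_gamma a' l'" ..
  have fin: "finite_measure (nc_gamma a l)" "finite_measure (nc_gamma a' l')"
    "finite_measure (nc_gamma a m)" "finite_measure (nc_gamma a' m')"
    "finite_measure (nc_gamma_difference c d a l m)" "finite_measure (nc_gamma_difference c d a' l' m')"
    by unfold_locales
  show "sets (nc_gamma_difference c d a l m \<star> nc_gamma_difference c d a' l' m')
    = sets (nc_gamma_difference c d (a + a') (l + l') (m + m'))" by simp
  fix E assume "E \<in> sets (nc_gamma_difference c d a l m \<star> nc_gamma_difference c d a' l' m')"
  then have E[measurable]: "E \<in> sets borel" by simp
  have "emeasure (nc_gamma_difference c d a l m \<star> nc_gamma_difference c d a' l' m') E
    = (\<integral>\<^sup>+x. \<integral>\<^sup>+y. indicator E (x + y) \<partial>nc_gamma_difference c d a' l' m' \<partial>nc_gamma_difference c d a l m)"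
    by (rule convolution_emeasure') (use fin in auto)
  also have "\<dots> = (\<integral>\<^sup>+s. \<integral>\<^sup>+t. \<integral>\<^sup>+s'. \<integral>\<^sup>+t'. indicator E ((c * s - d * t) + (c * s' - d * t'))
      \<partial>nc_gamma a' m' \<partial>nc_gamma a' l' \<partial>nc_gamma a m \<partial>nc_gamma a l)"
    by (simp add: nn_integral_nc_gamma_difference assms)
  also have "\<dots> = (\<integral>\<^sup>+s. \<integral>\<^sup>+s'. \<integral>\<^sup>+t. \<integral>\<^sup>+t'. indicator E ((c * s - d * t) + (c * s' - d * t'))
      \<partial>nc_gamma a' m' \<partial>nc_gamma a m \<partial>nc_gamma a' l' \<partial>nc_gamma a l)"
    by (intro nn_integral_cong C.Fubini'[symmetric]) measurable
  also have "\<dots> = (\<integral>\<^sup>+s. \<integral>\<^sup>+s'. \<integral>\<^sup>+t. indicator E (c * (s + s') - d * t)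
      \<partial>(nc_gamma a m \<star> nc_gamma a' m') \<partial>nc_gamma a' l' \<partial>nc_gamma a l)"
    by (subst nn_integral_convolution) (auto intro!: nn_integral_cong fin simp: algebra_simps)
  also have "\<dots> = (\<integral>\<^sup>+s. \<integral>\<^sup>+s'. \<integral>\<^sup>+t. indicator E (c * (s + s') - d * t)
      \<partial>nc_gamma (a + a') (m + m') \<partial>nc_gamma a' l' \<partial>nc_gamma a l)"
    by (simp add: nc_gamma_convolution assms)
  also have "\<dots> = (\<integral>\<^sup>+s. \<integral>\<^sup>+t. indicator E (c * s - d * t)
      \<partial>nc_gamma (a + a') (m + m') \<partial>(nc_gamma a l \<star> nc_gamma a' l'))"
  proof -
    interpret B2: prob_space "nc_gamma (a + a') (m + m')" by (rule prob_space_nc_gamma) (use assms in auto)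
    show ?thesis by (subst nn_integral_convolution) (auto intro!: fin)
  qed
  also have "\<dots> = emeasure (nc_gamma_difference c d (a + a') (l + l') (m + m')) E"
    using assms by (simp add: nc_gamma_convolution nn_integral_nc_gamma_difference[symmetric])
  finally show "emeasure (nc_gamma_difference c d a l m \<star> nc_gamma_difference c d a' l' m') E
    = emeasure (nc_gamma_difference c d (a + a') (l + l') (m + m')) E" .
qed

lemma (in prob_space) distr_sum_iid_nc_gamma_difference:
  fixes Zs :: "nat \<Rightarrow> 'a \<Rightarrow> real"
  assumes "a > 0" "l \<ge> 0" "m \<ge> 0" "n \<ge> 1"
    and "indep_vars (\<lambda>_. borel) Zs {1..n}"
    and "\<And>i. i \<in> {1..n} \<Longrightarrow> distr M borel (Zs i) = nc_gamma_difference c d a l m"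
  shows "distr M borel (\<lambda>\<omega>. \<Sum>i=1..n. Zs i \<omega>)
    = nc_gamma_difference c d (real n * a) (real n * l) (real n * m)"
  using assms(4-6)
proof (induction n rule: nat_induct_at_least)
  case base
  then show ?case by simp
next
  case (Suc n)
  have indep: "indep_vars (\<lambda>_. borel) Zs (insert (Suc n) {1..n})"
    using Suc.prems(1) by (simp add: atLeastAtMostSuc_conv)
  have rv[measurable]: "random_variable borel (Zs i)" if "i \<in> {1..Suc n}" for i
    using Suc.prems(1) that by (simp add: indep_vars_def)
  have "distr M borel (\<lambda>\<omega>. \<Sum>i=1..Suc n. Zs i \<omega>) = distr M borel (\<lambda>\<omega>. Zs (Suc n) \<omega> + (\<Sum>i=1..n. Zs i \<omega>))"
    by (simp add: add.commute)
  also have "\<dots> = (distr M borel (Zs (Suc n)) \<star> distr M borel (\<lambda>\<omega>. \<Sum>i=1..n. Zs i \<omega>))"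
    by (intro sum_indep_random_variable indep_vars_sum indep rv borel_measurable_sum) auto
  also have "distr M borel (\<lambda>\<omega>. \<Sum>i=1..n. Zs i \<omega>)
      = nc_gamma_difference c d (real n * a) (real n * l) (real n * m)"
    using Suc.prems by (intro Suc.IH indep_vars_subset[OF indep]) auto
  also have "distr M borel (Zs (Suc n)) = nc_gamma_difference c d a l m"
    using Suc.prems by simp
  also have "nc_gamma_difference c d a l m \<star> nc_gamma_difference c d (real n * a) (real n * l) (real n * m)
      = nc_gamma_difference c d (real (Suc n) * a) (real (Suc n) * l) (real (Suc n) * m)"
    using assms(1-3) Suc.hyps by (subst nc_gamma_difference_convolution) (auto simp: algebra_simps)
  finally show ?case .
qed

lemma emeasure_nc_gamma_difference_atMost_0:
  assumes "a > 0" "l \<ge> 0" "m \<ge> 0" "q > 0" "0 \<le> p" "p \<le> 1"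
  shows "emeasure (nc_gamma_difference (q * (1 - p)) (q * p) a l m) {..0}
    = (\<Sum>j. \<Sum>k. ennreal (poisson_weight l j * poisson_weight m k * reg_inc_beta p (a + real j) (a + real k)))"
proof -
  have sgn: "q * (1 - p) * s - q * p * t \<le> 0 \<longleftrightarrow> (1 - p) * s - p * t \<le> 0" for s t
  proof -
    have "q * (1 - p) * s - q * p * t = q * ((1 - p) * s - p * t)" by (simp add: algebra_simps)
    then show ?thesis using \<open>q > 0\<close> by (simp only: mult_le_0_iff) linarith
  qed
  have "emeasure (nc_gamma_difference (q * (1 - p)) (q * p) a l m) {..0}
      = (\<integral>\<^sup>+z. indicator {..0} z \<partial>nc_gamma_difference (q * (1 - p)) (q * p) a l m)" by simp
  also have "\<dots> = (\<integral>\<^sup>+s. \<integral>\<^sup>+t. indicator {..0} (q * (1 - p) * s - q * p * t) \<partial>nc_gamma a m \<partial>nc_gamma a l)"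
    by (rule nn_integral_nc_gamma_difference) (use assms in auto)
  also have "\<dots> = (\<integral>\<^sup>+s. \<integral>\<^sup>+t. indicator {..0} ((1 - p) * s - p * t) \<partial>nc_gamma a m \<partial>nc_gamma a l)"
    by (intro nn_integral_cong) (simp only: indicator_def atMost_iff sgn)
  also have "\<dots> = (\<Sum>j. \<Sum>k. ennreal (poisson_weight l j * poisson_weight m k * reg_inc_beta p (a + real j) (a + real k)))"
    by (rule nc_gamma_ratio_probability) (use assms in auto)
  finally show ?thesis .
qed

section \<open>The product of a bivariate normal pair\<close>

text \<open>
  The linear change of variables \<open>x = p (\<alpha> u + \<beta> v)/2\<close>, \<open>y = q (\<alpha> u - \<beta> v)/2\<close>, with Jacobian \<open>p q \<alpha> \<beta> / 2\<close>.
  It is composed of two one-dimensional affine substitutions: \<open>x = p (\<alpha> u - y/q)\<close> for fixed \<open>y\<close>,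
  and then \<open>y = q (\<alpha> u - \<beta> v)/2\<close> for fixed \<open>u\<close>.
\<close>
lemma nn_integral_lborel_rotate:
  fixes H :: "real \<Rightarrow> real \<Rightarrow> ennreal"
  assumes [measurable]: "case_prod H \<in> borel_measurable (borel \<Otimes>\<^sub>M borel)"
    and "p > 0" "q > 0" "\<alpha> > 0" "\<beta> > 0"
  shows "(\<integral>\<^sup>+x. \<integral>\<^sup>+y. H x y \<partial>lborel \<partial>lborel)
    = ennreal (p * q * \<alpha> * \<beta> / 2) *
      (\<integral>\<^sup>+u. \<integral>\<^sup>+v. H (p * ((\<alpha> * u + \<beta> * v) / 2)) (q * ((\<alpha> * u - \<beta> * v) / 2)) \<partial>lborel \<partial>lborel)"
proof -
  have "(\<integral>\<^sup>+x. \<integral>\<^sup>+y. H x y \<partial>lborel \<partial>lborel) = (\<integral>\<^sup>+y. \<integral>\<^sup>+x. H x y \<partial>lborel \<partial>lborel)"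
    by (rule lborel_pair.Fubini'[symmetric]) measurable
  also have "\<dots> = (\<integral>\<^sup>+y. ennreal (p * \<alpha>) * (\<integral>\<^sup>+u. H (p * (\<alpha> * u - y / q)) y \<partial>lborel) \<partial>lborel)"
  proof (rule nn_integral_cong)
    fix y :: real
    show "(\<integral>\<^sup>+x. H x y \<partial>lborel) = ennreal (p * \<alpha>) * (\<integral>\<^sup>+u. H (p * (\<alpha> * u - y / q)) y \<partial>lborel)"
      using assms by (subst nn_integral_real_affine[where c = "p * \<alpha>" and t = "- p * (y / q)"])
        (auto simp: algebra_simps)
  qed
  also have "\<dots> = ennreal (p * \<alpha>) * (\<integral>\<^sup>+y. \<integral>\<^sup>+u. H (p * (\<alpha> * u - y / q)) y \<partial>lborel \<partial>lborel)"
    by (rule nn_integral_cmult) measurable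
  also have "(\<integral>\<^sup>+y. \<integral>\<^sup>+u. H (p * (\<alpha> * u - y / q)) y \<partial>lborel \<partial>lborel)
      = (\<integral>\<^sup>+u. \<integral>\<^sup>+y. H (p * (\<alpha> * u - y / q)) y \<partial>lborel \<partial>lborel)"
    by (rule lborel_pair.Fubini') measurable
  also have "\<dots> = (\<integral>\<^sup>+u. ennreal (q * \<beta> / 2) *
      (\<integral>\<^sup>+v. H (p * ((\<alpha> * u + \<beta> * v) / 2)) (q * ((\<alpha> * u - \<beta> * v) / 2)) \<partial>lborel) \<partial>lborel)"
  proof (rule nn_integral_cong)
    fix u :: real
    have "(\<integral>\<^sup>+y. H (p * (\<alpha> * u - y / q)) y \<partial>lborel)
        = ennreal \<bar>- (q * \<beta> / 2)\<bar> * (\<integral>\<^sup>+v. H (p * (\<alpha> * u - (q * \<alpha> * u / 2 + - (q * \<beta> / 2) * v) / q))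
             (q * \<alpha> * u / 2 + - (q * \<beta> / 2) * v) \<partial>lborel)"
      using assms by (intro nn_integral_real_affine) auto
    also have "(\<lambda>v. H (p * (\<alpha> * u - (q * \<alpha> * u / 2 + - (q * \<beta> / 2) * v) / q)) (q * \<alpha> * u / 2 + - (q * \<beta> / 2) * v))
        = (\<lambda>v. H (p * ((\<alpha> * u + \<beta> * v) / 2)) (q * ((\<alpha> * u - \<beta> * v) / 2)))"
      using assms by (intro ext arg_cong2[where f = H]) (simp_all add: field_simps)
    finally show "(\<integral>\<^sup>+y. H (p * (\<alpha> * u - y / q)) y \<partial>lborel) = ennreal (q * \<beta> / 2) *
      (\<integral>\<^sup>+v. H (p * ((\<alpha> * u + \<beta> * v) / 2)) (q * ((\<alpha> * u - \<beta> * v) / 2)) \<partial>lborel)"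
      using assms by simp
  qed
  also have "\<dots> = ennreal (q * \<beta> / 2) * (\<integral>\<^sup>+u. \<integral>\<^sup>+v. H (p * ((\<alpha> * u + \<beta> * v) / 2)) (q * ((\<alpha> * u - \<beta> * v) / 2)) \<partial>lborel \<partial>lborel)"
    by (rule nn_integral_cmult) measurable
  finally have *: "(\<integral>\<^sup>+x. \<integral>\<^sup>+y. H x y \<partial>lborel \<partial>lborel) = ennreal (p * \<alpha>) * (ennreal (q * \<beta> / 2) *
      (\<integral>\<^sup>+u. \<integral>\<^sup>+v. H (p * ((\<alpha> * u + \<beta> * v) / 2)) (q * ((\<alpha> * u - \<beta> * v) / 2)) \<partial>lborel \<partial>lborel))" .
  have "ennreal (p * q * \<alpha> * \<beta> / 2) = ennreal (p * \<alpha>) * ennreal (q * \<beta> / 2)"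
    using assms by (subst ennreal_mult'[symmetric]) (auto simp: mult_ac)
  then show ?thesis unfolding * mult.assoc[symmetric, where 'a = ennreal] by (simp only:)
qed

text \<open>
  In centred coordinates the rotation diagonalises the quadratic form: \<open>x\<^sup>2 - 2 \<rho> x y + y\<^sup>2 = (1 - \<rho>\<^sup>2) (u\<^sup>2 + v\<^sup>2)\<close> for
  \<open>x = (\<alpha> u + \<beta> v)/2\<close>, \<open>y = (\<alpha> u - \<beta> v)/2\<close>, since \<open>\<alpha>\<^sup>2 = 2 (1 + \<rho>)\<close> and \<open>\<beta>\<^sup>2 = 2 (1 - \<rho>)\<close>; and the Jacobian
  cancels the correlation factor in the normalising constant because \<open>\<alpha> \<beta> = 2 sqrt (1 - \<rho>\<^sup>2)\<close>.
\<close>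
lemma bivariate_normal_density_rotate:
  fixes \<sigma>\<^sub>X \<sigma>\<^sub>Y \<rho> :: real
  assumes "\<sigma>\<^sub>X > 0" "\<sigma>\<^sub>Y > 0" "-1 < \<rho>" "\<rho> < 1"
  defines "\<alpha> \<equiv> sqrt (2 * (1 + \<rho>))" and "\<beta> \<equiv> sqrt (2 * (1 - \<rho>))"
  shows "\<sigma>\<^sub>X * \<sigma>\<^sub>Y * \<alpha> * \<beta> / 2 *
      bivariate_normal_density \<mu>\<^sub>X \<mu>\<^sub>Y \<sigma>\<^sub>X \<sigma>\<^sub>Y \<rho> (\<sigma>\<^sub>X * ((\<alpha> * u + \<beta> * v) / 2), \<sigma>\<^sub>Y * ((\<alpha> * u - \<beta> * v) / 2))
    = normal_density ((\<mu>\<^sub>X / \<sigma>\<^sub>X + \<mu>\<^sub>Y / \<sigma>\<^sub>Y) / \<alpha>) 1 u * normal_density ((\<mu>\<^sub>X / \<sigma>\<^sub>X - \<mu>\<^sub>Y / \<sigma>\<^sub>Y) / \<beta>) 1 v"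
proof -
  define U V where "U = u - (\<mu>\<^sub>X / \<sigma>\<^sub>X + \<mu>\<^sub>Y / \<sigma>\<^sub>Y) / \<alpha>" and "V = v - (\<mu>\<^sub>X / \<sigma>\<^sub>X - \<mu>\<^sub>Y / \<sigma>\<^sub>Y) / \<beta>"
  have pos: "\<alpha> > 0" "\<beta> > 0" using assms by (auto simp: \<alpha>_def \<beta>_def)
  have sq: "\<alpha>\<^sup>2 = 2 * (1 + \<rho>)" "\<beta>\<^sup>2 = 2 * (1 - \<rho>)" using assms by (auto simp: \<alpha>_def \<beta>_def)
  have r: "1 - \<rho>\<^sup>2 = (1 + \<rho>) * (1 - \<rho>)" by (simp add: power2_eq_square algebra_simps)
  have r0: "1 - \<rho>\<^sup>2 > 0" unfolding r using assms by simp
  have ab: "\<alpha> * \<beta> = 2 * sqrt (1 - \<rho>\<^sup>2)"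
    unfolding r \<alpha>_def \<beta>_def real_sqrt_mult by simp
  have x: "(\<sigma>\<^sub>X * ((\<alpha> * u + \<beta> * v) / 2) - \<mu>\<^sub>X) / \<sigma>\<^sub>X = (\<alpha> * U + \<beta> * V) / 2"
    and y: "(\<sigma>\<^sub>Y * ((\<alpha> * u - \<beta> * v) / 2) - \<mu>\<^sub>Y) / \<sigma>\<^sub>Y = (\<alpha> * U - \<beta> * V) / 2"
    using assms(1,2) pos by (simp_all add: U_def V_def field_simps)
  have "((\<alpha> * U + \<beta> * V) / 2)\<^sup>2 - 2 * \<rho> * ((\<alpha> * U + \<beta> * V) / 2) * ((\<alpha> * U - \<beta> * V) / 2) + ((\<alpha> * U - \<beta> * V) / 2)\<^sup>2
      = \<alpha>\<^sup>2 * U\<^sup>2 * (1 - \<rho>) / 2 + \<beta>\<^sup>2 * V\<^sup>2 * (1 + \<rho>) / 2"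
    by (simp add: power2_eq_square field_simps)
  also have "\<dots> = (1 - \<rho>\<^sup>2) * (U\<^sup>2 + V\<^sup>2)"
    unfolding sq r by (simp add: field_simps)
  finally have quad: "((\<alpha> * U + \<beta> * V) / 2)\<^sup>2 - 2 * \<rho> * ((\<alpha> * U + \<beta> * V) / 2) * ((\<alpha> * U - \<beta> * V) / 2)
      + ((\<alpha> * U - \<beta> * V) / 2)\<^sup>2 = (1 - \<rho>\<^sup>2) * (U\<^sup>2 + V\<^sup>2)" .
  have e: "- ((1 - \<rho>\<^sup>2) * (U\<^sup>2 + V\<^sup>2)) / (2 * (1 - \<rho>\<^sup>2)) = - U\<^sup>2 / 2 + - V\<^sup>2 / 2"
    using r0 by (simp add: divide_simps algebra_simps)
  have "\<sigma>\<^sub>X * \<sigma>\<^sub>Y * \<alpha> * \<beta> / 2 *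
      bivariate_normal_density \<mu>\<^sub>X \<mu>\<^sub>Y \<sigma>\<^sub>X \<sigma>\<^sub>Y \<rho> (\<sigma>\<^sub>X * ((\<alpha> * u + \<beta> * v) / 2), \<sigma>\<^sub>Y * ((\<alpha> * u - \<beta> * v) / 2))
      = (\<sigma>\<^sub>X * \<sigma>\<^sub>Y * (\<alpha> * \<beta>) / 2) / (2 * pi * \<sigma>\<^sub>X * \<sigma>\<^sub>Y * sqrt (1 - \<rho>\<^sup>2)) * exp (- U\<^sup>2 / 2 + - V\<^sup>2 / 2)"
    unfolding bivariate_normal_density_def prod.case x y quad e by simp
  also have "\<dots> = 1 / (2 * pi) * exp (- U\<^sup>2 / 2) * exp (- V\<^sup>2 / 2)"
    unfolding ab exp_add using assms(1,2) r0 by simp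
  also have "\<dots> = normal_density ((\<mu>\<^sub>X / \<sigma>\<^sub>X + \<mu>\<^sub>Y / \<sigma>\<^sub>Y) / \<alpha>) 1 u * normal_density ((\<mu>\<^sub>X / \<sigma>\<^sub>X - \<mu>\<^sub>Y / \<sigma>\<^sub>Y) / \<beta>) 1 v"
    by (simp add: normal_density_def U_def V_def)
  finally show ?thesis .
qed

lemma nn_integral_nc_gamma_half:
  assumes [measurable]: "F \<in> borel_measurable borel"
  shows "(\<integral>\<^sup>+s. F s \<partial>nc_gamma (1 / 2) (m\<^sup>2 / 2)) = (\<integral>\<^sup>+u. ennreal (normal_density m 1 u) * F (u\<^sup>2 / 2) \<partial>lborel)"
  by (simp add: distr_half_square_normal[symmetric] nn_integral_distr nn_integral_density)

text \<open>
  In the rotated coordinates \<open>X Y\<close> is a difference of squares, \<open>x y = \<sigma>\<^sub>X \<sigma>\<^sub>Y (\<alpha>\<^sup>2 u\<^sup>2 - \<beta>\<^sup>2 v\<^sup>2) / 4\<close>, and the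
  coordinates are independent.
\<close>
lemma distr_bivariate_normal_product:
  fixes \<sigma>\<^sub>X \<sigma>\<^sub>Y \<rho> :: real
  assumes s: "\<sigma>\<^sub>X > 0" "\<sigma>\<^sub>Y > 0" "-1 < \<rho>" "\<rho> < 1"
    and bn: "bivariate_normal N X Y \<mu>\<^sub>X \<mu>\<^sub>Y \<sigma>\<^sub>X \<sigma>\<^sub>Y \<rho>"
  shows "distr N borel (\<lambda>\<omega>. X \<omega> * Y \<omega>) = nc_gamma_difference (\<sigma>\<^sub>X * \<sigma>\<^sub>Y * (1 + \<rho>)) (\<sigma>\<^sub>X * \<sigma>\<^sub>Y * (1 - \<rho>)) (1 / 2)
     ((\<mu>\<^sub>X / \<sigma>\<^sub>X + \<mu>\<^sub>Y / \<sigma>\<^sub>Y)\<^sup>2 / (4 * (1 + \<rho>))) ((\<mu>\<^sub>X / \<sigma>\<^sub>X - \<mu>\<^sub>Y / \<sigma>\<^sub>Y)\<^sup>2 / (4 * (1 - \<rho>)))"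
    (is "?L = nc_gamma_difference ?c ?d _ ?l ?m")
proof (rule measure_eqI)
  let ?D = "bivariate_normal_density \<mu>\<^sub>X \<mu>\<^sub>Y \<sigma>\<^sub>X \<sigma>\<^sub>Y \<rho>"
  define \<alpha> \<beta> where ab: "\<alpha> = sqrt (2 * (1 + \<rho>))" "\<beta> = sqrt (2 * (1 - \<rho>))"
  have pos: "\<alpha> > 0" "\<beta> > 0" using s by (auto simp: ab)
  have sq: "\<alpha>\<^sup>2 = 2 * (1 + \<rho>)" "\<beta>\<^sup>2 = 2 * (1 - \<rho>)" using s by (auto simp: ab)
  define m\<^sub>U m\<^sub>V where mUV: "m\<^sub>U = (\<mu>\<^sub>X / \<sigma>\<^sub>X + \<mu>\<^sub>Y / \<sigma>\<^sub>Y) / \<alpha>" "m\<^sub>V = (\<mu>\<^sub>X / \<sigma>\<^sub>X - \<mu>\<^sub>Y / \<sigma>\<^sub>Y) / \<beta>"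
  have lm: "?l = m\<^sub>U\<^sup>2 / 2" "?m = m\<^sub>V\<^sup>2 / 2"
    unfolding mUV power_divide sq by (simp_all add: field_simps)
  interpret B: prob_space "nc_gamma (1 / 2) (m\<^sub>V\<^sup>2 / 2)" by (rule prob_space_nc_gamma) auto
  have Dm[measurable]: "?D \<in> borel_measurable (borel \<Otimes>\<^sub>M borel)"
    unfolding bivariate_normal_density_def by measurable
  have XY: "(\<lambda>\<omega>. (X \<omega>, Y \<omega>)) \<in> measurable N (lborel \<Otimes>\<^sub>M lborel)"
    and dXY: "distr N (lborel \<Otimes>\<^sub>M lborel) (\<lambda>\<omega>. (X \<omega>, Y \<omega>)) = density (lborel \<Otimes>\<^sub>M lborel) (\<lambda>p. ennreal (?D p))"
    using bn by (auto simp: bivariate_normal_def distributed_def)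
  show "sets ?L = sets (nc_gamma_difference ?c ?d (1 / 2) ?l ?m)" by simp
  fix E assume "E \<in> sets ?L"
  then have E[measurable]: "E \<in> sets borel" by simp
  have "?L = distr (distr N (lborel \<Otimes>\<^sub>M lborel) (\<lambda>\<omega>. (X \<omega>, Y \<omega>))) borel (\<lambda>(x, y). x * y)"
    using XY by (subst distr_distr) (auto simp: comp_def)
  then have "emeasure ?L E = emeasure (distr (density (lborel \<Otimes>\<^sub>M lborel) (\<lambda>p. ennreal (?D p))) borel (\<lambda>(x, y). x * y)) E"
    by (simp only: dXY)
  also have "\<dots> = (\<integral>\<^sup>+z. indicator E z \<partial>distr (density (lborel \<Otimes>\<^sub>M lborel) (\<lambda>p. ennreal (?D p))) borel (\<lambda>(x, y). x * y))"
    by simp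
  also have "\<dots> = (\<integral>\<^sup>+p. ennreal (?D p) * indicator E (fst p * snd p) \<partial>(lborel \<Otimes>\<^sub>M lborel))"
    by (subst nn_integral_distr) (auto simp: nn_integral_density case_prod_unfold)
  also have "\<dots> = (\<integral>\<^sup>+x. \<integral>\<^sup>+y. ennreal (?D (x, y)) * indicator E (x * y) \<partial>lborel \<partial>lborel)"
    by (subst lborel.nn_integral_fst[symmetric]) auto
  also have "\<dots> = ennreal (\<sigma>\<^sub>X * \<sigma>\<^sub>Y * \<alpha> * \<beta> / 2) * (\<integral>\<^sup>+u. \<integral>\<^sup>+v.
      ennreal (?D (\<sigma>\<^sub>X * ((\<alpha> * u + \<beta> * v) / 2), \<sigma>\<^sub>Y * ((\<alpha> * u - \<beta> * v) / 2)))
      * indicator E (\<sigma>\<^sub>X * ((\<alpha> * u + \<beta> * v) / 2) * (\<sigma>\<^sub>Y * ((\<alpha> * u - \<beta> * v) / 2))) \<partial>lborel \<partial>lborel)"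
    using s pos by (intro nn_integral_lborel_rotate) auto
  also have "\<dots> = (\<integral>\<^sup>+u. \<integral>\<^sup>+v. ennreal (\<sigma>\<^sub>X * \<sigma>\<^sub>Y * \<alpha> * \<beta> / 2) *
      (ennreal (?D (\<sigma>\<^sub>X * ((\<alpha> * u + \<beta> * v) / 2), \<sigma>\<^sub>Y * ((\<alpha> * u - \<beta> * v) / 2)))
      * indicator E (\<sigma>\<^sub>X * ((\<alpha> * u + \<beta> * v) / 2) * (\<sigma>\<^sub>Y * ((\<alpha> * u - \<beta> * v) / 2)))) \<partial>lborel \<partial>lborel)"
    by (simp add: nn_integral_cmult)
  also have "\<dots> = (\<integral>\<^sup>+u. \<integral>\<^sup>+v. ennreal (normal_density m\<^sub>U 1 u) * (ennreal (normal_density m\<^sub>V 1 v)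
      * indicator E (?c * (u\<^sup>2 / 2) - ?d * (v\<^sup>2 / 2))) \<partial>lborel \<partial>lborel)"
  proof (intro nn_integral_cong)
    fix u v :: real
    have "\<sigma>\<^sub>X * ((\<alpha> * u + \<beta> * v) / 2) * (\<sigma>\<^sub>Y * ((\<alpha> * u - \<beta> * v) / 2))
        = \<sigma>\<^sub>X * \<sigma>\<^sub>Y * (\<alpha>\<^sup>2 * u\<^sup>2 - \<beta>\<^sup>2 * v\<^sup>2) / 4"
      by (simp add: power2_eq_square field_simps)
    also have "\<dots> = ?c * (u\<^sup>2 / 2) - ?d * (v\<^sup>2 / 2)"
      unfolding sq by (simp add: field_simps)
    finally have prod: "\<sigma>\<^sub>X * ((\<alpha> * u + \<beta> * v) / 2) * (\<sigma>\<^sub>Y * ((\<alpha> * u - \<beta> * v) / 2))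
        = ?c * (u\<^sup>2 / 2) - ?d * (v\<^sup>2 / 2)" .
    have "ennreal (\<sigma>\<^sub>X * \<sigma>\<^sub>Y * \<alpha> * \<beta> / 2) * ennreal (?D (\<sigma>\<^sub>X * ((\<alpha> * u + \<beta> * v) / 2), \<sigma>\<^sub>Y * ((\<alpha> * u - \<beta> * v) / 2)))
        = ennreal (\<sigma>\<^sub>X * \<sigma>\<^sub>Y * \<alpha> * \<beta> / 2 * ?D (\<sigma>\<^sub>X * ((\<alpha> * u + \<beta> * v) / 2), \<sigma>\<^sub>Y * ((\<alpha> * u - \<beta> * v) / 2)))"
      using s pos by (intro ennreal_mult'[symmetric]) simp
    also have "\<dots> = ennreal (normal_density m\<^sub>U 1 u) * ennreal (normal_density m\<^sub>V 1 v)"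
      using bivariate_normal_density_rotate[OF s] by (simp add: ab mUV ennreal_mult')
    finally have dens: "ennreal (\<sigma>\<^sub>X * \<sigma>\<^sub>Y * \<alpha> * \<beta> / 2) *
        ennreal (?D (\<sigma>\<^sub>X * ((\<alpha> * u + \<beta> * v) / 2), \<sigma>\<^sub>Y * ((\<alpha> * u - \<beta> * v) / 2)))
        = ennreal (normal_density m\<^sub>U 1 u) * ennreal (normal_density m\<^sub>V 1 v)" .
    show "ennreal (\<sigma>\<^sub>X * \<sigma>\<^sub>Y * \<alpha> * \<beta> / 2) *
      (ennreal (?D (\<sigma>\<^sub>X * ((\<alpha> * u + \<beta> * v) / 2), \<sigma>\<^sub>Y * ((\<alpha> * u - \<beta> * v) / 2)))
      * indicator E (\<sigma>\<^sub>X * ((\<alpha> * u + \<beta> * v) / 2) * (\<sigma>\<^sub>Y * ((\<alpha> * u - \<beta> * v) / 2))))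
      = ennreal (normal_density m\<^sub>U 1 u) * (ennreal (normal_density m\<^sub>V 1 v)
      * indicator E (?c * (u\<^sup>2 / 2) - ?d * (v\<^sup>2 / 2)))"
      unfolding prod by (simp only: mult.assoc[symmetric, where 'a = ennreal] dens)
  qed
  also have "\<dots> = (\<integral>\<^sup>+s. \<integral>\<^sup>+t. indicator E (?c * s - ?d * t) \<partial>nc_gamma (1 / 2) (m\<^sub>V\<^sup>2 / 2) \<partial>nc_gamma (1 / 2) (m\<^sub>U\<^sup>2 / 2))"
    by (simp add: nn_integral_nc_gamma_half nn_integral_cmult)
  also have "\<dots> = (\<integral>\<^sup>+z. indicator E z \<partial>nc_gamma_difference ?c ?d (1 / 2) (m\<^sub>U\<^sup>2 / 2) (m\<^sub>V\<^sup>2 / 2))"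
    by (rule nn_integral_nc_gamma_difference[symmetric]) auto
  also have "\<dots> = emeasure (nc_gamma_difference ?c ?d (1 / 2) ?l ?m) E" unfolding lm by simp
  finally show "emeasure ?L E = emeasure (nc_gamma_difference ?c ?d (1 / 2) ?l ?m) E" .
qed

section \<open>The probability of a nonpositive sum of products\<close>

text \<open>
  Turns an identity between extended nonnegative double series into one between real series, the finite
  value supplying the summability of every row and of the row sums.
\<close>
lemma double_suminf_real_of_ennreal:
  fixes t :: "nat \<Rightarrow> nat \<Rightarrow> real"
  assumes nonneg: "\<And>j k. t j k \<ge> 0" and "r \<ge> 0"
    and eq: "ennreal r = (\<Sum>j. \<Sum>k. ennreal (t j k))"
  shows "\<forall>j. summable (t j)" "summable (\<lambda>j. \<Sum>k. t j k)" "r = (\<Sum>j. \<Sum>k. t j k)"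
proof -
  have row: "summable (t j)" for j
  proof (rule summable_suminf_not_top[OF nonneg])
    have "(\<Sum>k. ennreal (t j k)) \<le> (\<Sum>j. \<Sum>k. ennreal (t j k))"
      using sum_le_suminf[OF summableI, of "{j}" "\<lambda>j. \<Sum>k. ennreal (t j k)"] by simp
    then show "(\<Sum>k. ennreal (t j k)) \<noteq> top"
      unfolding eq[symmetric] by (metis ennreal_neq_top neq_top_trans)
  qed
  then show "\<forall>j. summable (t j)" ..
  have row_nonneg: "(\<Sum>k. t j k) \<ge> 0" for j
    by (rule suminf_nonneg[OF row nonneg])
  have eq': "ennreal r = (\<Sum>j. ennreal (\<Sum>k. t j k))"
    unfolding eq by (intro suminf_cong suminf_ennreal2 nonneg row)
  show s: "summable (\<lambda>j. \<Sum>k. t j k)"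
    by (rule summable_suminf_not_top[OF row_nonneg]) (simp add: eq'[symmetric])
  have "ennreal r = ennreal (\<Sum>j. \<Sum>k. t j k)"
    unfolding eq' by (rule suminf_ennreal2[OF row_nonneg s])
  then show "r = (\<Sum>j. \<Sum>k. t j k)"
    using \<open>r \<ge> 0\<close> suminf_nonneg[OF s row_nonneg] by (simp add: ennreal_inj)
qed

theorem corollary2p12:
  fixes N :: "'a measure" and M :: "'b measure"
    and X Y Z :: "'a \<Rightarrow> real" and Zs :: "nat \<Rightarrow> 'b \<Rightarrow> real"
    and \<mu>\<^sub>X \<mu>\<^sub>Y \<sigma>\<^sub>X \<sigma>\<^sub>Y \<rho> \<Lambda>\<^sub>p \<Lambda>\<^sub>m :: real and n :: nat and c :: "nat \<Rightarrow> nat \<Rightarrow> real"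
  assumes "\<sigma>\<^sub>X > 0" and "\<sigma>\<^sub>Y > 0" and "-1 < \<rho>" and "\<rho> < 1" and "n \<ge> 1"
    and "prob_space N"
    and "bivariate_normal N X Y \<mu>\<^sub>X \<mu>\<^sub>Y \<sigma>\<^sub>X \<sigma>\<^sub>Y \<rho>"
    and "Z = (\<lambda>\<omega>. X \<omega> * Y \<omega>)"
    and "prob_space M"
    and "prob_space.indep_vars M (\<lambda>_. borel) Zs {1..n}"
    and "\<And>i. i \<in> {1..n} \<Longrightarrow> distr M borel (Zs i) = distr N borel Z"
    and "\<Lambda>\<^sub>p = real n / (2 * (1 + \<rho>)) * (\<mu>\<^sub>X / \<sigma>\<^sub>X + \<mu>\<^sub>Y / \<sigma>\<^sub>Y)\<^sup>2"
    and "\<Lambda>\<^sub>m = real n / (2 * (1 - \<rho>)) * (\<mu>\<^sub>X / \<sigma>\<^sub>X - \<mu>\<^sub>Y / \<sigma>\<^sub>Y)\<^sup>2"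
    and "\<And>j k. c j k = 1 / (fact j * fact k) * (\<Lambda>\<^sub>p / 2) ^ j * (\<Lambda>\<^sub>m / 2) ^ k
           * reg_inc_beta ((1 - \<rho>) / 2) (real n / 2 + real j) (real n / 2 + real k)"
  shows "(\<forall>j. summable (\<lambda>k. c j k)) \<and> summable (\<lambda>j. \<Sum>k. c j k) \<and>
    measure M {\<omega> \<in> space M. (\<Sum>i=1..n. Zs i \<omega>) \<le> 0}
      = exp (- (\<Lambda>\<^sub>p + \<Lambda>\<^sub>m) / 2) * (\<Sum>j. \<Sum>k. c j k)"
proof -
  note pos = assms(1-4) and n = assms(5) and bn = assms(7) and Z = assms(8)
    and indep = assms(10) and same = assms(11) and \<Lambda> = assms(12,13) and c = assms(14)
  interpret M: prob_space M by fact
  \<comment> \<open>The factor 2 compensates the halves in \<open>?p\<close> and \<open>1 - ?p = (1 + \<rho>) / 2\<close>.\<close>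
  let ?q = "2 * \<sigma>\<^sub>X * \<sigma>\<^sub>Y" and ?p = "(1 - \<rho>) / 2"
  let ?a = "real n / 2"
  let ?S = "\<lambda>\<omega>. \<Sum>i=1..n. Zs i \<omega>"
  define t where "t j k = poisson_weight (\<Lambda>\<^sub>p / 2) j * poisson_weight (\<Lambda>\<^sub>m / 2) k *
    reg_inc_beta ?p (?a + real j) (?a + real k)" for j k
  \<comment> \<open>The Poisson means for a single product, half the squared means of \<open>U\<close> and \<open>V\<close>.\<close>
  define l m where lm: "l = (\<mu>\<^sub>X / \<sigma>\<^sub>X + \<mu>\<^sub>Y / \<sigma>\<^sub>Y)\<^sup>2 / (4 * (1 + \<rho>))" "m = (\<mu>\<^sub>X / \<sigma>\<^sub>X - \<mu>\<^sub>Y / \<sigma>\<^sub>Y)\<^sup>2 / (4 * (1 - \<rho>))"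
  have lm0: "l \<ge> 0" "m \<ge> 0" using pos by (auto simp: lm)
  have scale: "real n * l = \<Lambda>\<^sub>p / 2" "real n * m = \<Lambda>\<^sub>m / 2" "real n * (1 / 2) = ?a"
    by (simp_all add: lm \<Lambda>)
  have \<Lambda>0: "\<Lambda>\<^sub>p / 2 \<ge> 0" "\<Lambda>\<^sub>m / 2 \<ge> 0" using pos by (auto simp: \<Lambda>)
  have coeff: "\<sigma>\<^sub>X * \<sigma>\<^sub>Y * (1 + \<rho>) = ?q * (1 - ?p)" "\<sigma>\<^sub>X * \<sigma>\<^sub>Y * (1 - \<rho>) = ?q * ?p"
    by (simp_all add: field_simps)
  have law: "distr M borel (Zs i) = nc_gamma_difference (?q * (1 - ?p)) (?q * ?p) (1 / 2) l m" if "i \<in> {1..n}" for i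
    using same[OF that] distr_bivariate_normal_product[OF pos bn] by (simp only: Z coeff lm)
  have Zs[measurable]: "Zs i \<in> borel_measurable M" if "i \<in> {1..n}" for i
    using indep that by (simp add: M.indep_vars_def)
  have "emeasure M {\<omega> \<in> space M. ?S \<omega> \<le> 0} = emeasure (distr M borel ?S) {..0}"
    by (subst emeasure_distr) (auto intro!: arg_cong[where f = "emeasure M"])
  also have "distr M borel ?S = nc_gamma_difference (?q * (1 - ?p)) (?q * ?p) ?a (\<Lambda>\<^sub>p / 2) (\<Lambda>\<^sub>m / 2)"
    unfolding scale[symmetric]
    by (rule M.distr_sum_iid_nc_gamma_difference[OF _ lm0 n indep law]) simp
  also have "emeasure \<dots> {..0} = (\<Sum>j. \<Sum>k. ennreal (t j k))"
    unfolding t_def by (rule emeasure_nc_gamma_difference_atMost_0) (use pos n \<Lambda>0 in auto)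
  finally have eq: "ennreal (measure M {\<omega> \<in> space M. ?S \<omega> \<le> 0}) = (\<Sum>j. \<Sum>k. ennreal (t j k))"
    by (simp add: M.emeasure_eq_measure)
  have "t j k \<ge> 0" for j k
    unfolding t_def using pos n \<Lambda>0 by (intro mult_nonneg_nonneg poisson_weight_nonneg reg_inc_beta_nonneg) auto
  note sums = double_suminf_real_of_ennreal[OF this measure_nonneg eq]
  have ct: "c j k = exp ((\<Lambda>\<^sub>p + \<Lambda>\<^sub>m) / 2) * t j k" for j k
  proof -
    have "exp ((\<Lambda>\<^sub>p + \<Lambda>\<^sub>m) / 2) * (exp (- (\<Lambda>\<^sub>p / 2)) * exp (- (\<Lambda>\<^sub>m / 2))) = 1"
      by (simp add: exp_add[symmetric] add_divide_distrib)
    then show ?thesis by (simp add: c t_def poisson_weight_def)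
  qed
  have rows: "\<forall>j. summable (\<lambda>k. c j k)"
    unfolding ct using sums(1) by (auto intro: summable_mult)
  have row_sum: "(\<Sum>k. c j k) = exp ((\<Lambda>\<^sub>p + \<Lambda>\<^sub>m) / 2) * (\<Sum>k. t j k)" for j
    unfolding ct using sums(1) by (intro suminf_mult) auto
  have "summable (\<lambda>j. \<Sum>k. c j k)"
    unfolding row_sum by (rule summable_mult[OF sums(2)])
  moreover have "exp (- (\<Lambda>\<^sub>p + \<Lambda>\<^sub>m) / 2) * (\<Sum>j. \<Sum>k. c j k) = (\<Sum>j. \<Sum>k. t j k)"
    unfolding row_sum suminf_mult[OF sums(2)]
    by (simp add: mult.assoc[symmetric] exp_add[symmetric] add_divide_distrib[symmetric])
  ultimately show ?thesis using rows sums(3) by simp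
qed

end
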